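(* Fix an integer $k \geq 2$ and integers $m_2, m_3, \ldots, m_k$ with $0 \leq m_i < i$ for all $i$. Then there exists $n \geq 0$ with $\bar{b}_i(n) = m_i$ for all $2 \leq i \leq k$ if and only if, for every $i \in \{2, \ldots, k\}$ and every divisor $d$ of $i$ with $1 < d < i$ that is a power of a prime, \[ m_i + m_{i-1} + \cdots + m_{i-d+1} \equiv 0 \pmod{d}. \] Moreover, if $\bar{b}_i(n) = m_i$ for all $2 \leq i \leq k$, then also $\bar{b}_i(n + r \cdot \mathrm{lcm}(2, \ldots, k)) = m_i$ for all $2 \leq i \leq k$ and all integers $r$ with $n + r\cdot \mathrm{lcm}(2, \ldots, k) \geq 0$.
   Context: Tchoukaillon boards. For each $n \geq 0$ define a sequence $b(n) = (b_1(n), b_2(n), \ldots)$ of nonnegative integers recursively: $b(0)$ is the all-zero sequence; given $b(n)$, let $p(n) = \min\{j \geq 1 : b_j(n) = 0\}$ and set $b_i(n+1) = b_i(n)$ if $i > p(n)$, $b_i(n+1) = i$ if $i = p(n)$, and $b_i(n+1) = b_i(n) - 1$ if $i < p(n)$. Reindexed boards: $\bar{b}_i(n) = b_{i-1}(n)$ for $i \geq 2$ (so $0 \le \bar b_i(n) < i$). *)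

theory Defs
  imports "HOL-Number_Theory.Number_Theory" "HOL-Number_Theory.Prime_Powers"
begin

text \<open>
  \<open>tchouk_board n i\<close> is the entry $b_i(n)$ of the Tchoukaillon board with index \<open>n\<close>; the
  boards are sequences indexed by \<open>i \<ge> 1\<close>, so the entry at position 0 (always 0) carries no
  meaning. The function \<open>first_empty\<close> gives $p(n)$ when applied to the board $b(n)$.
  The truncated subtraction never truncates at a position \<open>1 \<le> i < first_empty b\<close>, since
  such an entry is positive.
\<close>

definition first_empty :: "(nat \<Rightarrow> nat) \<Rightarrow> nat" where
  "first_empty b = (LEAST j. 1 \<le> j \<and> b j = 0)"

primrec tchouk_board :: "nat \<Rightarrow> nat \<Rightarrow> nat" where
  "tchouk_board 0 = (\<lambda>i. 0)"
| "tchouk_board (Suc n) =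
     (let b = tchouk_board n; p = first_empty b
      in (\<lambda>i. if i > p then b i else if i = p then i else b i - 1))"

text \<open>The reindexed entry $\bar b_i(n)$, meaningful for \<open>i \<ge> 2\<close>.\<close>

definition tchouk_bar :: "nat \<Rightarrow> nat \<Rightarrow> nat" where
  "tchouk_bar n i = tchouk_board n (i - 1)"

text \<open>
  Finitely many entries of each board are nonzero, so the minimum defining $p(n)$ is attained.
\<close>

lemma tchouk_board_eq_0: "i > n \<Longrightarrow> tchouk_board n i = 0"
proof (induction n arbitrary: i)
  case (Suc n)
  have "first_empty (tchouk_board n) \<le> Suc n"
    unfolding first_empty_def by (rule Least_le) (simp add: Suc.IH)
  with Suc show ?case by (simp add: Let_def)
qed simp

lemma first_empty_tchouk_board:
  "1 \<le> first_empty (tchouk_board n) \<and> tchouk_board n (first_empty (tchouk_board n)) = 0"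
  unfolding first_empty_def by (rule LeastI[of _ "Suc n"]) (simp add: tchouk_board_eq_0)

end

theory Submission
  imports Defs
begin

text \<open>
  A move preserves the fact that $i$ divides
  $n - (b_1(n) + \dots + b_{i-1}(n))$. Put $M_i = m_2 + \dots + m_i$. Since $0 \le \bar b_i(n) < i$, the entries
  $\bar b_2(n), \dots, \bar b_k(n)$ equal $m_2, \dots, m_k$ iff $n \equiv M_i \pmod i$ for all
  $2 \le i \le k$. This yields the periodicity, and solvability of the system of congruences
  amounts to all multiples $i \le k$ of a prime power $d$ having the same residue of $M_i$
  modulo $d$. The condition on sums of $d$ consecutive entries says
  $M_i \equiv M_{i-d} \pmod d$, which is the same by induction.
\<close>

lemma tchouk_board_le: "tchouk_board n i \<le> i"
proof (induction n arbitrary: i)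
  case (Suc n)
  have "tchouk_board n i - 1 \<le> i" using Suc[of i] by simp
  with Suc[of i] show ?case by (simp add: Let_def)
qed simp

lemma tchouk_board_pos:
  assumes "1 \<le> i" "i < first_empty (tchouk_board n)"
  shows "tchouk_board n i > 0"
  using not_less_Least[OF assms(2)[unfolded first_empty_def]] assms(1) by simp

text \<open>A prefix ending before \<open>p\<close> loses one from each of its \<open>i\<close>
  entries. A prefix reaching \<open>p\<close> loses \<open>p - 1\<close> from the earlier entries
  and gains \<open>p\<close> at position \<open>p\<close>, a net change of 1.\<close>

lemma tchouk_board_Suc_sum:
  fixes n i :: nat
  defines "p \<equiv> first_empty (tchouk_board n)"
  shows "(\<Sum>j=1..i. int (tchouk_board (Suc n) j)) =
           (\<Sum>j=1..i. int (tchouk_board n j)) + (if i < p then - int i else 1)"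
proof (induction i)
  case 0
  \<comment> \<open>Since \<open>p\<close> is at least 1, the correction for the empty prefix is
    \<open>- int 0\<close> and not 1.\<close>
  then show ?case using first_empty_tchouk_board[of n] by (simp add: p_def)
next
  case (Suc i)
  have "int (tchouk_board (Suc n) (Suc i)) = int (tchouk_board n (Suc i)) +
          (if Suc i < p then -1 else if Suc i = p then int p else 0)"
  proof (cases "Suc i" p rule: linorder_cases)
    case less
    \<comment> \<open>Positivity makes the truncated subtraction a genuine decrease by 1.\<close>
    then have "tchouk_board n (Suc i) > 0" by (intro tchouk_board_pos) (simp_all add: p_def)
    with less show ?thesis by (simp add: Let_def flip: p_def)
  next
    case equal
    have "tchouk_board n p = 0" using first_empty_tchouk_board by (simp add: p_def)
    with equal show ?thesis by (simp add: Let_def flip: p_def)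
  next
    case greater
    then show ?thesis by (simp add: Let_def flip: p_def)
  qed
  with Suc show ?case by (auto simp del: tchouk_board.simps)
qed

text \<open>In a move \<open>n\<close> grows by 1 and the prefix sum changes by 1 or by
  \<open>- i\<close>, so their difference changes by 0 or by \<open>i + 1\<close>.\<close>

lemma tchouk_board_sum_cong:
  "[int n = (\<Sum>j=1..i. int (tchouk_board n j))] (mod int (Suc i))"
proof (induction n)
  case (Suc n)
  obtain c where c: "int n - (\<Sum>j=1..i. int (tchouk_board n j)) = int (Suc i) * c"
    using Suc.IH by (auto simp: cong_iff_dvd_diff)
  have "int (Suc n) - (\<Sum>j=1..i. int (tchouk_board (Suc n) j)) =
          int (Suc i) * (c + (if i < first_empty (tchouk_board n) then 1 else 0))"
    unfolding tchouk_board_Suc_sum using c by (simp add: algebra_simps)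
  then show ?case unfolding cong_iff_dvd_diff by (metis dvd_triv_left)
qed simp

lemma tchouk_bar_less: "i > 0 \<Longrightarrow> tchouk_bar n i < i"
  using tchouk_board_le[of n "i - 1"] by (simp add: tchouk_bar_def)

lemma tchouk_bar_sum_cong:
  assumes "i > 0"
  shows "[int n = (\<Sum>j=2..i. int (tchouk_bar n j))] (mod int i)"
proof -
  obtain i' where i': "i = Suc i'" using assms gr0_conv_Suc by blast
  have "(\<Sum>j=2..i. int (tchouk_bar n j)) = (\<Sum>j=1..i'. int (tchouk_board n j))"
    unfolding i' using sum.shift_bounds_cl_Suc_ivl[of "\<lambda>j. int (tchouk_bar n j)" 1 i']
    by (simp add: tchouk_bar_def numeral_2_eq_2)
  then show ?thesis using tchouk_board_sum_cong[of n i'] i' by simp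
qed

text \<open>The congruences determine the entries one at a time: once all entries below
  \<open>i\<close> agree, the congruence modulo \<open>i\<close> fixes the entry at \<open>i\<close>
  modulo \<open>i\<close>, and both candidates lie between 0 and \<open>i - 1\<close>.\<close>

lemma tchouk_bar_eq_iff_cong:
  fixes k n :: nat and m :: "nat \<Rightarrow> int"
  assumes bounds: "\<forall>i\<in>{2..k}. 0 \<le> m i \<and> m i < int i"
  shows "(\<forall>i\<in>{2..k}. int (tchouk_bar n i) = m i) \<longleftrightarrow>
         (\<forall>i\<in>{2..k}. [int n = (\<Sum>j=2..i. m j)] (mod int i))"
proof
  assume eq: "\<forall>i\<in>{2..k}. int (tchouk_bar n i) = m i"
  show "\<forall>i\<in>{2..k}. [int n = (\<Sum>j=2..i. m j)] (mod int i)"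
  proof
    fix i assume i: "i \<in> {2..k}"
    have "(\<Sum>j=2..i. int (tchouk_bar n j)) = (\<Sum>j=2..i. m j)"
      using eq i by (intro sum.cong) auto
    then show "[int n = (\<Sum>j=2..i. m j)] (mod int i)"
      using tchouk_bar_sum_cong[of i n] i by simp
  qed
next
  assume cong: "\<forall>i\<in>{2..k}. [int n = (\<Sum>j=2..i. m j)] (mod int i)"
  have "int (tchouk_bar n i) = m i" if "i \<in> {2..k}" for i
    using that
  proof (induction i rule: less_induct)
    case (less i)
    then have i: "2 \<le> i" "i \<le> k" by auto
    have split: "(\<Sum>j=2..i. f j) = f i + (\<Sum>j\<in>{2..<i}. f j)" for f :: "nat \<Rightarrow> int"
      using i by (metis add.commute sum.last_plus)
    have "(\<Sum>j\<in>{2..<i}. int (tchouk_bar n j)) = (\<Sum>j\<in>{2..<i}. m j)"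
      using less.IH i by (intro sum.cong) auto
    moreover have "[(\<Sum>j=2..i. int (tchouk_bar n j)) = (\<Sum>j=2..i. m j)] (mod int i)"
      using tchouk_bar_sum_cong[of i n] cong i
      by (meson atLeastAtMost_iff cong_sym cong_trans less.prems zero_less_numeral less_le_trans)
    ultimately have "[int (tchouk_bar n i) = m i] (mod int i)"
      by (simp add: split cong_add_rcancel)
    then show ?case
      using bounds i tchouk_bar_less[of i n] by (intro cong_less_imp_eq_int) auto
  qed
  then show "\<forall>i\<in>{2..k}. int (tchouk_bar n i) = m i" by blast
qed

lemma cong_if_cong_primepow:
  fixes x y :: int and i :: nat
  assumes "i > 0" and cong: "\<And>d. primepow d \<Longrightarrow> d dvd i \<Longrightarrow> [x = y] (mod int d)"
  shows "[x = y] (mod int i)"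
proof -
  have "i dvd nat \<bar>x - y\<bar>"
  proof (cases "x = y")
    case False
    show ?thesis
    proof (rule multiplicity_le_imp_dvd)
      fix p :: nat assume p: "prime p"
      show "multiplicity p i \<le> multiplicity p (nat \<bar>x - y\<bar>)"
      proof (cases "multiplicity p i = 0")
        case False
        \<comment> \<open>The full power of \<open>p\<close> in \<open>i\<close> suffices; a nonzero
          exponent makes it a \<open>primepow\<close>.\<close>
        then have "[x = y] (mod int (p ^ multiplicity p i))"
          using p by (intro cong) (auto simp: multiplicity_dvd primepow_prime_power)
        then have "p ^ multiplicity p i dvd nat \<bar>x - y\<bar>"
          by (simp add: cong_iff_dvd_diff flip: int_dvd_int_iff of_nat_power)
        then show ?thesis
          using p \<open>x \<noteq> y\<close> by (intro multiplicity_geI) (auto simp: prime_gt_1_nat)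
      qed simp
    qed (use assms(1) in auto)
  qed simp
  then show ?thesis by (simp add: cong_iff_dvd_diff flip: int_dvd_int_iff)
qed

text \<open>The moduli are not coprime, so the Chinese remainder theorem is applied only to the
  highest power of each prime up to \<open>k\<close>. The hypothesis \<open>compat\<close> then
  carries the congruences to all prime powers dividing some \<open>i\<close>.\<close>

lemma simultaneous_cong_primepow:
  fixes M :: "nat \<Rightarrow> int" and k :: nat
  assumes compat: "\<And>d i. primepow d \<Longrightarrow> d dvd i \<Longrightarrow> 0 < i \<Longrightarrow> i \<le> k \<Longrightarrow> [M i = M d] (mod int d)"
  shows "\<exists>n::nat. \<forall>i\<in>{1..k}. [int n = M i] (mod int i)"
proof -
  define e where "e p = (GREATEST a. p ^ a \<le> k)" for p :: nat
  define P where "P = {p::nat. prime p \<and> p \<le> k}"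
  \<comment> \<open>The bound \<open>a < 2 ^ a \<le> p ^ a \<le> k\<close> ensures that the greatest
    exponent \<open>e p\<close> exists.\<close>
  have exp_le: "a \<le> k" if "prime p" "p ^ a \<le> k" for p a :: nat
    using that less_exp[of a] power_mono[OF prime_ge_2_nat[OF that(1)], of a] by linarith
  have e_greatest: "a \<le> e p" if "prime p" "p ^ a \<le> k" for p a
    unfolding e_def using that exp_le by (intro Greatest_le_nat[where b = k]) auto
  have e_le: "p ^ e p \<le> k" if "p \<in> P" for p
    unfolding e_def using that exp_le
    by (intro GreatestI_nat[where b = k and k = 1 and P = "\<lambda>a. p ^ a \<le> k"]) (auto simp: P_def)
  \<comment> \<open>Reducing the integer \<open>M (p ^ e p)\<close> modulo \<open>p ^ e p\<close>
    gives a natural number as the target residue.\<close>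
  have "\<exists>x. \<forall>p\<in>P. [x = nat (M (p ^ e p) mod int (p ^ e p))] (mod p ^ e p)"
  proof (rule chinese_remainder_nat)
    show "finite P" by (rule finite_subset[of _ "{..k}"]) (auto simp: P_def)
    show "\<forall>p\<in>P. \<forall>q\<in>P. p \<noteq> q \<longrightarrow> coprime (p ^ e p) (q ^ e q)"
      by (auto simp: P_def intro!: primes_coprime)
  qed
  then obtain n where n: "\<And>p. p \<in> P \<Longrightarrow> [n = nat (M (p ^ e p) mod int (p ^ e p))] (mod p ^ e p)"
    by blast
  have n_int: "[int n = M (p ^ e p)] (mod int (p ^ e p))" if "p \<in> P" for p
  proof -
    have "p ^ e p > 0" using that by (simp add: P_def prime_gt_0_nat)
    then have "int (nat (M (p ^ e p) mod int (p ^ e p))) = M (p ^ e p) mod int (p ^ e p)"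
      by (metis nat_0_le of_nat_0_less_iff pos_mod_sign)
    moreover have "[int n = int (nat (M (p ^ e p) mod int (p ^ e p)))] (mod int (p ^ e p))"
      using n[OF that] by (simp only: cong_int_iff)
    ultimately show ?thesis by (simp add: cong_def)
  qed
  have "[int n = M i] (mod int i)" if i: "i \<in> {1..k}" for i
  proof (rule cong_if_cong_primepow)
    fix d :: nat assume d: "primepow d" "d dvd i"
    obtain p a where pa: "prime p" "a > 0" "d = p ^ a"
      using d(1) by (auto simp: primepow_def)
    have "d \<le> k" using d(2) i by (auto dest: dvd_imp_le)
    then have a_le: "a \<le> e p" using e_greatest pa by simp
    have "p \<le> d" using pa by (simp add: dvd_imp_le prime_gt_0_nat)
    then have p: "p \<in> P" using pa \<open>d \<le> k\<close> by (simp add: P_def)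
    have dvd: "d dvd p ^ e p" using pa a_le by (simp add: le_imp_power_dvd)
    \<comment> \<open>As \<open>d\<close> divides both \<open>p ^ e p\<close> and \<open>i\<close>,
      the values of \<open>M\<close> at these two multiples are compared through
      \<open>M d\<close>.\<close>
    have "[int n = M (p ^ e p)] (mod int d)"
      using n_int[OF p] dvd by (metis cong_dvd_modulus int_dvd_int_iff)
    also have "[M (p ^ e p) = M d] (mod int d)"
      using p pa(1) by (intro compat d(1) dvd e_le) (simp_all add: prime_gt_0_nat)
    also have "[M d = M i] (mod int d)"
      using compat[OF d] i by (simp add: cong_sym)
    finally show "[int n = M i] (mod int d)" .
  qed (use i in auto)
  then show ?thesis by blast
qed

theorem theorem4p5:
  fixes k :: nat and m :: "nat \<Rightarrow> int"
  assumes "k \<ge> 2"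
    and "\<forall>i\<in>{2..k}. 0 \<le> m i \<and> m i < int i"
  shows "((\<exists>n. \<forall>i\<in>{2..k}. int (tchouk_bar n i) = m i) \<longleftrightarrow>
           (\<forall>i\<in>{2..k}. \<forall>d. d dvd i \<and> 1 < d \<and> d < i \<and> primepow d \<longrightarrow>
              [(\<Sum>j = i - d + 1..i. m j) = 0] (mod (int d))))
       \<and> (\<forall>n. (\<forall>i\<in>{2..k}. int (tchouk_bar n i) = m i) \<longrightarrow>
            (\<forall>r::int. int n + r * int (Lcm {2..k}) \<ge> 0 \<longrightarrow>
              (\<forall>i\<in>{2..k}. int (tchouk_bar (nat (int n + r * int (Lcm {2..k}))) i) = m i)))"
proof -
  define M where "M i = (\<Sum>j=2..i. m j)" for i
  have iff: "(\<forall>i\<in>{2..k}. int (tchouk_bar n i) = m i) \<longleftrightarrow>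
             (\<forall>i\<in>{2..k}. [int n = M i] (mod int i))" for n
    unfolding M_def using tchouk_bar_eq_iff_cong[OF assms(2)] .
  have window: "(\<Sum>j = i - d + 1..i. m j) = M i - M (i - d)" if "d dvd i" "1 < d" "d < i" for i d
  proof -
    \<comment> \<open>Hence \<open>i - d\<close> is at least 2, so the window of \<open>d\<close>
      terms starts inside the range of \<open>M i\<close>.\<close>
    have "d \<le> i - d" using that by (simp add: dvd_imp_le)
    then have "{2..i} = {2..i - d} \<union> {i - d + 1..i}" using that by auto
    then have "M i = M (i - d) + (\<Sum>j = i - d + 1..i. m j)"
      unfolding M_def by (simp add: sum.union_disjoint)
    then show ?thesis by simp
  qed
  have solvable: "(\<exists>n. \<forall>i\<in>{2..k}. [int n = M i] (mod int i)) \<longleftrightarrow>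
      (\<forall>i\<in>{2..k}. \<forall>d. d dvd i \<and> 1 < d \<and> d < i \<and> primepow d \<longrightarrow>
         [(\<Sum>j = i - d + 1..i. m j) = 0] (mod (int d)))" (is "?L \<longleftrightarrow> ?R")
  proof
    assume ?L
    then obtain n where n: "\<And>i. i \<in> {2..k} \<Longrightarrow> [int n = M i] (mod int i)" by blast
    have "[(\<Sum>j = i - d + 1..i. m j) = 0] (mod int d)"
      if i: "i \<in> {2..k}" and d: "d dvd i" "1 < d" "d < i" for i d
    proof -
      have "d dvd i - d" "d \<le> i - d" using d by (simp_all add: dvd_imp_le)
      \<comment> \<open>Both \<open>i\<close> and \<open>i - d\<close> are indices in
        \<open>{2..k}\<close> and multiples of \<open>d\<close>, so \<open>n\<close> links
        \<open>M i\<close> to \<open>M (i - d)\<close> modulo \<open>d\<close>.\<close>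
      then have "[int n = M i] (mod int i)" "[int n = M (i - d)] (mod int (i - d))"
        using i d \<open>d \<le> i - d\<close> by (intro n; simp)+
      then have "[int n = M i] (mod int d)" "[int n = M (i - d)] (mod int d)"
        using d(1) \<open>d dvd i - d\<close> by (metis cong_dvd_modulus int_dvd_int_iff)+
      then have "[M i = M (i - d)] (mod int d)" by (meson cong_sym cong_trans)
      then show ?thesis by (simp only: window[OF d] cong_diff_iff_cong_0)
    qed
    then show ?R by blast
  next
    assume R: ?R
    \<comment> \<open>Descent in steps of \<open>d\<close>: each window condition passes from
      \<open>i\<close> to the smaller positive multiple \<open>i - d\<close>, until \<open>d\<close>
      is reached.\<close>
    have "[M i = M d] (mod int d)" if "primepow d" "d dvd i" "0 < i" "i \<le> k" for d i
      using that(2-4)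
    proof (induction i rule: less_induct)
      case (less i)
      show ?case
      proof (cases "i = d")
        case False
        have d: "1 < d" using that(1) by (rule primepow_gt_Suc_0[unfolded One_nat_def[symmetric]])
        have "d < i" using less.prems False by (simp add: dvd_imp_le le_neq_implies_less)
        have "i \<in> {2..k}" using less.prems d \<open>d < i\<close> by simp
        then have "[(\<Sum>j = i - d + 1..i. m j) = 0] (mod int d)"
          using R less.prems(1) d \<open>d < i\<close> that(1) by blast
        then have "[M i - M (i - d) = 0] (mod int d)"
          by (simp only: window[OF less.prems(1) d \<open>d < i\<close>])
        then have "[M i = M (i - d)] (mod int d)" by (simp only: cong_diff_iff_cong_0)
        also have "[M (i - d) = M d] (mod int d)"
          using less.prems d \<open>d < i\<close> by (intro less.IH) auto
        finally show ?thesis .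
      qed simp
    qed
    then obtain n :: nat where "\<forall>i\<in>{1..k}. [int n = M i] (mod int i)"
      using simultaneous_cong_primepow[of k M] by blast
    then show ?L by (intro exI[of _ n]) simp
  qed
  have periodic: "\<forall>i\<in>{2..k}. [int (nat (int n + r * int (Lcm {2..k}))) = M i] (mod int i)"
    if n: "\<forall>i\<in>{2..k}. [int n = M i] (mod int i)" and nonneg: "int n + r * int (Lcm {2..k}) \<ge> 0"
    for n and r :: int
  proof
    fix i assume i: "i \<in> {2..k}"
    \<comment> \<open>The shift vanishes modulo every \<open>i\<close>; \<open>r\<close> may be
      negative, and \<open>nonneg\<close> makes the conversion by \<open>nat\<close>
      faithful.\<close>
    then have "int i dvd r * int (Lcm {2..k})" by (simp add: dvd_Lcm)
    then have "[int n + r * int (Lcm {2..k}) = int n] (mod int i)"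
      by (simp add: cong_iff_dvd_diff)
    then show "[int (nat (int n + r * int (Lcm {2..k}))) = M i] (mod int i)"
      using n i nonneg cong_trans[of _ "int n" "int i" "M i"] by (simp only: int_nat_eq if_True)
  qed
  show ?thesis using solvable periodic unfolding iff by blast
qed

end
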